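(* Assume that the standing assumptions (A1)-(A12) listed in the context hold. Then there exists $h_{0}\in(0,1)$ such that for all $h\in(0,h_{0})$ (where $h=T/N$, $N\in\mathbb{N}$) there exists a unique solution $(\theta_{n+1},\varphi_{n+1})$, $n=0,\dots,N-1$, of the discrete problem $$ \begin{cases} \delta_{h}\theta_{n}+\eta\,\delta_{h}\varphi_{n}+A_{1}\theta_{n+1}=0,\\ Lz_{n+1}+B_{1}v_{n+1}+A_{2}\varphi_{n+1}+\Phi\varphi_{n+1}+\mathcal{L}\varphi_{n+1}=B_{2}\theta_{n+1},\\ z_{0}=z_{1},\quad z_{n+1}=\delta_{h}v_{n},\\ v_{n+1}=\delta_{h}\varphi_{n} \end{cases} \qquad (n=0,\dots,N-1) $$ with the given initial data $\theta_0,\varphi_0,v_0$, satisfying $$\theta_{n+1}\in D(A_{1}),\quad \varphi_{n+1}\in D(B_{1})\cap D(A_{2})\quad\text{for } n=0,\dots,N-1.$$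
   Context: Setting. $T>0$ and $\eta>0$ are real constants; $h=T/N$ with $N\in\mathbb{N}$ is the time step, and $\delta_{h}\theta_{n}:=\frac{\theta_{n+1}-\theta_{n}}{h}$, $\delta_{h}\varphi_{n}:=\frac{\varphi_{n+1}-\varphi_{n}}{h}$, $\delta_{h}v_{n}:=\frac{v_{n+1}-v_{n}}{h}$. $(\cdot,\cdot)_H$ is the inner product of $H$, $\langle\cdot,\cdot\rangle_{V^*,V}$ the duality pairing, $I$ the identity. Standing assumptions. (A1) $V$ and $H$ are real Hilbert spaces, $V\subset H$ with dense, continuous and compact embedding; $V\subset H\subset V^{*}$ by identifying $H$ with its dual, where $V^*$ is the dual of $V$. (A2) $L:H\to H$ is a bounded linear operator with $(Lw,z)_H=(w,Lz)_H$ for all $w,z\in H$ and $(Lw,w)_H\ge c_L\|w\|_H^2$ for all $w\in H$, where $c_L>0$ is a constant. (A3) $A_j:D(A_j)\subset H\to H$ ($j=1,2$) are linear maximal monotone selfadjoint operators, $D(A_j)$ being linear subspaces of $H$ with $D(A_j)\subset V$. There exist bounded linear monotone operators $A_j^*:V\to V^*$ ($j=1,2$) such that $\langle A_j^*w,z\rangle_{V^*,V}=\langle A_j^*z,w\rangle_{V^*,V}$ for all $w,z\in V$, and $A_j^*w=A_jw$ for all $w\in D(A_j)$. Moreover, for all $\alpha>0$ and $j=1,2$ there exists $\omega_{j,\alpha}>0$ such that $\langle A_j^*w,w\rangle_{V^*,V}+\alpha\|w\|_H^2\ge\omega_{j,\alpha}\|w\|_V^2$ for all $w\in V$. (A4)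 $B_j:D(B_j)\subset H\to H$ ($j=1,2$) are linear maximal monotone selfadjoint operators, $D(B_j)$ being linear subspaces of $H$, with $D(A_1)\subset D(B_2)$, $D(B_1)\cap D(A_2)\ne\emptyset$, $(B_1w,A_2w)_H\ge0$ for all $w\in D(B_1)\cap D(A_2)$, $(B_2w,A_1w)_H\ge0$ for all $w\in D(A_1)$, and $(B_1w,A_2z)_H=(B_1z,A_2w)_H$ for all $w,z\in D(B_1)\cap D(A_2)$. Moreover $D(A_2)\subset V$. (A5) There is a constant $C_{A_1,B_2}>0$ with $\|B_2\theta\|_H\le C_{A_1,B_2}(\|A_1\theta\|_H+\|\theta\|_H)$ for all $\theta\in D(A_1)$. (A6) $\Phi:D(\Phi)\subset H\to H$ is a (single-valued) maximal monotone operator with $\Phi(0)=0$ and $V\subset D(\Phi)$; there exist constants $p,q,C_\Phi>0$ with $\|\Phi w-\Phi z\|_H\le C_\Phi(1+\|w\|_V^p+\|z\|_V^q)\|w-z\|_V$ for all $w,z\in V$. (A7) There is a lower semicontinuous convex function $i:V\to\{x\in\mathbb{R}\mid x\ge0\}$ with $(\Phi w,w-z)_H\ge i(w)-i(z)$ for all $w,z\in V$. (A8) For $\lambda>0$ let $\Phi_\lambda:H\to H$ be the Yosida approximation of $\Phi$. Then $\Phi_\lambda(0)=0$, $(\Phi_\lambda w,B_1w)_H\ge0$ for all $w\in D(B_1)$, and $(\Phi_\lambda w,A_2w)_H\ge0$ for all $w\in D(A_2)$. (A9) $B_j^*:V\to V^*$ ($j=1,2$) are bounded linear monotone operators with $\langle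 B_j^*w,z\rangle_{V^*,V}=\langle B_j^*z,w\rangle_{V^*,V}$ for all $w,z\in V$ and $B_j^*w=B_jw$ for all $w\in D(B_j)\cap V$. (A10) For all $g\in H$, $a,b,c,d,d'>0$, $\lambda>0$, $h>0$: if $\varphi_\lambda\in V$ satisfies $L\varphi_\lambda+aB_1^*\varphi_\lambda+bA_2^*\varphi_\lambda+c\Phi_\lambda\varphi_\lambda+d\mathcal{L}\varphi_\lambda+d'B_2(I+hA_1)^{-1}\varphi_\lambda=g$ in $V^*$, then $\varphi_\lambda\in D(B_1)\cap D(A_2)$ and $L\varphi_\lambda+aB_1\varphi_\lambda+bA_2\varphi_\lambda+c\Phi_\lambda\varphi_\lambda+d\mathcal{L}\varphi_\lambda+d'B_2(I+hA_1)^{-1}\varphi_\lambda=g$ in $H$. (A11) $\mathcal{L}:H\to H$ is Lipschitz continuous with Lipschitz constant $C_{\mathcal{L}}>0$. (A12) $\theta_0\in D(A_1)$, $A_1\theta_0\in V$, $\varphi_0\in D(B_1)\cap D(A_2)$, $v_0\in D(B_1)\cap V$. *)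

theory Defs
  imports "HOL-Analysis.Analysis"
begin

text \<open>
  An operator \<open>A : D(A) \<subset> H \<rightarrow> H\<close> is a partial function \<open>A :: 'h \<rightharpoonup> 'h\<close>:
  its domain \<open>D(A)\<close> is \<^term>\<open>dom A\<close> and its graph is \<^term>\<open>Map.graph A\<close>.
  Values are only meaningful on \<^term>\<open>dom A\<close>.
\<close>

abbreviation op_app :: "('h \<rightharpoonup> 'h) \<Rightarrow> 'h \<Rightarrow> 'h"  (infixr "\<cdot>" 90)
  where "A \<cdot> x \<equiv> the (A x)"

definition linear_op :: "('h::real_vector \<rightharpoonup> 'h) \<Rightarrow> bool" where
  "linear_op A \<longleftrightarrow> subspace (dom A) \<and>
     (\<forall>x\<in>dom A. \<forall>y\<in>dom A. A \<cdot> (x + y) = A \<cdot> x + A \<cdot> y) \<and>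
     (\<forall>c. \<forall>x\<in>dom A. A \<cdot> (c *\<^sub>R x) = c *\<^sub>R (A \<cdot> x))"

definition monotone_graph :: "('h::real_inner \<times> 'h) set \<Rightarrow> bool" where
  "monotone_graph G \<longleftrightarrow> (\<forall>(x, y)\<in>G. \<forall>(x', y')\<in>G. 0 \<le> inner (y - y') (x - x'))"

text \<open>Maximality is among all, possibly multivalued, monotone operators.\<close>

definition maximal_monotone :: "('h::real_inner \<rightharpoonup> 'h) \<Rightarrow> bool" where
  "maximal_monotone A \<longleftrightarrow> monotone_graph (Map.graph A) \<and>
     (\<forall>G. monotone_graph G \<and> Map.graph A \<subseteq> G \<longrightarrow> G = Map.graph A)"

definition adjoint_graph :: "('h::real_inner \<rightharpoonup> 'h) \<Rightarrow> ('h \<times> 'h) set" where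
  "adjoint_graph A = {(y, z). \<forall>x\<in>dom A. inner (A \<cdot> x) y = inner x z}"

text \<open>Selfadjointness of an unbounded operator: densely defined and equal to its
  adjoint, including equality of the domains.\<close>

definition selfadjoint :: "('h::real_inner \<rightharpoonup> 'h) \<Rightarrow> bool" where
  "selfadjoint A \<longleftrightarrow> closure (dom A) = UNIV \<and> adjoint_graph A = Map.graph A"

text \<open>\<open>(I + \<lambda>A)\<^sup>-\<^sup>1\<close>; for maximal monotone \<open>A\<close> and \<open>\<lambda> > 0\<close> the described point exists
  and is unique.\<close>

definition resolvent :: "('h::real_inner \<rightharpoonup> 'h) \<Rightarrow> real \<Rightarrow> 'h \<Rightarrow> 'h" where
  "resolvent A lam x = (THE y. y \<in> dom A \<and> y + lam *\<^sub>R (A \<cdot> y) = x)"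

definition yosida :: "('h::real_inner \<rightharpoonup> 'h) \<Rightarrow> real \<Rightarrow> 'h \<Rightarrow> 'h" where
  "yosida A lam x = (x - resolvent A lam x) /\<^sub>R lam"

text \<open>
  The inclusion \<open>V \<subset> H\<close> is an injective bounded linear map \<open>e\<close> from the type of \<open>V\<close> to
  that of \<open>H\<close>, so \<open>V\<close> as a subset of \<open>H\<close> is \<open>range e\<close>; the dual \<open>V\<^sup>*\<close> is the type of
  bounded linear functionals on \<open>V\<close>.
\<close>

definition dense_compact_embedding ::
    "('v::real_inner \<Rightarrow>\<^sub>L 'h::real_inner) \<Rightarrow> bool" where
  "dense_compact_embedding e \<longleftrightarrow> inj (blinfun_apply e) \<and> closure (range e) = UNIV \<and>
     (\<forall>S. bounded S \<longrightarrow> compact (closure (e ` S)))"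

text \<open>The inclusion \<open>H \<subset> V\<^sup>*\<close> obtained by identifying \<open>H\<close> with its dual.\<close>

definition to_dual ::
    "('v::real_inner \<Rightarrow>\<^sub>L 'h::real_inner) \<Rightarrow> 'h \<Rightarrow> ('v \<Rightarrow>\<^sub>L real)" where
  "to_dual e x = blinfun_inner_right x o\<^sub>L e"

text \<open>\<open>S\<close> is a monotone symmetric operator \<open>V \<rightarrow> V\<^sup>*\<close> that agrees with \<open>A\<close> on \<open>D(A) \<inter> V\<close>;
  boundedness and linearity of \<open>S\<close> are in its type.\<close>

definition weak_form ::
    "('v::real_inner \<Rightarrow>\<^sub>L 'h::real_inner) \<Rightarrow> ('h \<rightharpoonup> 'h) \<Rightarrow> ('v \<Rightarrow>\<^sub>L 'v \<Rightarrow>\<^sub>L real) \<Rightarrow> bool" where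
  "weak_form e A S \<longleftrightarrow>
     (\<forall>w z. 0 \<le> (S w - S z) (w - z)) \<and>
     (\<forall>w z. S w z = S z w) \<and>
     (\<forall>w. e w \<in> dom A \<longrightarrow> S w = to_dual e (A \<cdot> e w))"

definition lower_semicontinuous :: "('v::topological_space \<Rightarrow> real) \<Rightarrow> bool" where
  "lower_semicontinuous f \<longleftrightarrow> (\<forall>x r. r < f x \<longrightarrow> (\<forall>\<^sub>F y in nhds x. r < f y))"

definition delta :: "real \<Rightarrow> (nat \<Rightarrow> 'h::real_vector) \<Rightarrow> nat \<Rightarrow> 'h" where
  "delta h u n = (u (Suc n) - u n) /\<^sub>R h"

text \<open>
  Only the values \<open>\<theta> n\<close>, \<open>\<phi> n\<close> with \<open>n \<le> N\<close> are constrained. The membership conditions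
  are exactly those needed for every term of the scheme to be defined.
\<close>

definition discrete_solution ::
    "real \<Rightarrow> nat \<Rightarrow> real \<Rightarrow> ('h::real_inner \<Rightarrow>\<^sub>L 'h) \<Rightarrow> ('h \<rightharpoonup> 'h) \<Rightarrow> ('h \<rightharpoonup> 'h) \<Rightarrow>
     ('h \<rightharpoonup> 'h) \<Rightarrow> ('h \<rightharpoonup> 'h) \<Rightarrow> ('h \<rightharpoonup> 'h) \<Rightarrow> ('h \<Rightarrow> 'h) \<Rightarrow> 'h \<Rightarrow> 'h \<Rightarrow> 'h \<Rightarrow>
     (nat \<Rightarrow> 'h) \<Rightarrow> (nat \<Rightarrow> 'h) \<Rightarrow> bool" where
  "discrete_solution h N \<eta> L A1 A2 B1 B2 \<Phi> LL \<theta>0 \<phi>0 v0 \<theta> \<phi> \<longleftrightarrow>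
     (\<exists>v z. \<theta> 0 = \<theta>0 \<and> \<phi> 0 = \<phi>0 \<and> v 0 = v0 \<and> z 0 = z 1 \<and>
       (\<forall>n<N.
          \<theta> (Suc n) \<in> dom A1 \<inter> dom B2 \<and> \<phi> (Suc n) \<in> dom A2 \<inter> dom \<Phi> \<and>
          v (Suc n) \<in> dom B1 \<and>
          delta h \<theta> n + \<eta> *\<^sub>R delta h \<phi> n + A1 \<cdot> \<theta> (Suc n) = 0 \<and>
          L (z (Suc n)) + B1 \<cdot> v (Suc n) + A2 \<cdot> \<phi> (Suc n) + \<Phi> \<cdot> \<phi> (Suc n) + LL (\<phi> (Suc n))
            = B2 \<cdot> \<theta> (Suc n) \<and>
          z (Suc n) = delta h v n \<and>
          v (Suc n) = delta h \<phi> n))"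

end

theory Submission
  imports Defs
begin

text \<open>
  Eliminating \<open>\<theta>\<close> by the resolvent \<open>J = (I + h A\<^sub>1)\<^sup>-\<^sup>1\<close>, one time step becomes the equation
  \<open>L \<phi> + h\<^sup>2 \<Phi> \<phi> + h\<^sup>2 \<L> \<phi> + \<eta> h\<^sup>2 B\<^sub>2 J \<phi> + h B\<^sub>1 \<phi> + h\<^sup>2 A\<^sub>2 \<phi> = g\<close> in \<open>H\<close>. Its left-hand side is
  strongly monotone once \<open>h\<^sup>2 C\<^sub>\<L> < c\<^sub>L\<close>, since \<open>B\<^sub>2 J\<close> is monotone by \<open>(B\<^sub>2 w, A\<^sub>1 w) \<ge> 0\<close>; this gives
  uniqueness. As a map from \<open>V\<close> to \<open>V\<^sup>*\<close> it is moreover Lipschitz on bounded sets, because \<open>\<Phi>\<close>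
  is, and strongly monotone maps of this kind are onto, so the equation has a weak solution
  with the operator \<open>\<Phi>\<close> itself. Regularity then follows from (A10).
\<close>

section \<open>Functionals and strongly monotone maps on a Hilbert space\<close>

text \<open>Variational argument: if \<open>a\<close> represents \<open>f\<close>, then
  \<open>J x\<close> below equals the squared distance from \<open>x\<close> to \<open>a\<close>
  minus the squared norm of \<open>a\<close>. So the representing vector is sought as a minimiser of
  \<open>J\<close>, which exists by completeness.\<close>

lemma Riesz_representation:
  fixes f :: "'v::{real_inner,banach} \<Rightarrow>\<^sub>L real"
  shows "\<exists>x. \<forall>y. f y = inner x y"
proof -
  define J where "J x = (norm x)\<^sup>2 - 2 * f x" for x
  have lower: "- (norm f)\<^sup>2 \<le> J x" for x
  proof -
    have "f x \<le> norm f * norm x"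
      using norm_blinfun[of f x] by (simp add: abs_le_iff)
    then have "J x \<ge> (norm x - norm f)\<^sup>2 - (norm f)\<^sup>2"
      by (simp add: J_def power2_diff algebra_simps)
    then show ?thesis by (smt (verit) zero_le_power2)
  qed
  define m where "m = Inf (range J)"
  have bdd: "bdd_below (range J)"
    using lower by (auto simp: bdd_below_def)
  have m_le: "m \<le> J x" for x
    unfolding m_def using bdd by (simp add: cInf_lower)
  have "\<exists>x. J x < m + inverse (real (Suc n))" for n
    using cInf_lessD[of "range J" "m + inverse (real (Suc n))"] by (auto simp: m_def)
  then obtain x where x: "J (x n) < m + inverse (real (Suc n))" for n by metis
  \<comment> \<open>The parallelogram identity at the midpoint of \<open>u\<close> and
    \<open>w\<close>, where \<open>J\<close> is still at least \<open>m\<close>. Hence points with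
    almost minimal \<open>J\<close> are close together, and the minimising sequence is
    Cauchy.\<close>
  have par: "(norm (u - w))\<^sup>2 \<le> 2 * (J u - m) + 2 * (J w - m)" for u w
  proof -
    have "J u + J w = 2 * J ((1/2) *\<^sub>R (u + w)) + (norm (u - w))\<^sup>2 / 2"
      unfolding J_def power2_norm_eq_inner
      by (simp add: blinfun.bilinear_simps inner_commute algebra_simps) (simp add: field_simps)
    with m_le[of "(1/2) *\<^sub>R (u + w)"] show ?thesis by simp
  qed
  have "Cauchy x"
  proof (rule metric_CauchyI)
    fix r :: real assume "0 < r"
    then have "0 < r\<^sup>2 / 4" by simp
    then obtain M where M: "inverse (real (Suc M)) < r\<^sup>2 / 4"
      using reals_Archimedean by blast
    have "dist (x n) (x k) < r" if "M \<le> n" "M \<le> k" for n k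
    proof -
      have "inverse (real (Suc n)) < r\<^sup>2 / 4" "inverse (real (Suc k)) < r\<^sup>2 / 4"
        by (rule le_less_trans[OF _ M], use that in simp)+
      then have "J (x n) - m < r\<^sup>2 / 4" "J (x k) - m < r\<^sup>2 / 4"
        using x[of n] x[of k] by linarith+
      with par[of "x n" "x k"] have "(norm (x n - x k))\<^sup>2 < r\<^sup>2" by simp
      then show ?thesis using \<open>0 < r\<close> by (simp add: dist_norm power_less_imp_less_base)
    qed
    then show "\<exists>M. \<forall>m\<ge>M. \<forall>n\<ge>M. dist (x m) (x n) < r" by blast
  qed
  then obtain a where a: "x \<longlonglongrightarrow> a"
    using Cauchy_convergent_iff convergent_def by blast
  have "(\<lambda>n. J (x n)) \<longlonglongrightarrow> J a"
    unfolding J_def by (intro tendsto_intros a)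
  moreover have "(\<lambda>n. m + inverse (real (Suc n))) \<longlonglongrightarrow> m + 0"
    by (intro tendsto_intros LIMSEQ_inverse_real_of_nat)
  ultimately have "J a \<le> m + 0"
    by (rule LIMSEQ_le) (use x less_imp_le in blast)
  then have min: "J a \<le> J y" for y using m_le[of y] by simp
  have "f y = inner a y" for y
  proof (rule ccontr)
    assume "f y \<noteq> inner a y"
    define d where "d = f y - inner a y"
    have "d \<noteq> 0" using \<open>f y \<noteq> inner a y\<close> by (simp add: d_def)
    have "y \<noteq> 0" using \<open>f y \<noteq> inner a y\<close> by (auto simp: blinfun.zero_right)
    \<comment> \<open>The minimiser of the quadratic
      \<open>t \<mapsto> J (a + t *\<^sub>R y)\<close>; the value there is strictly below
      \<open>J a\<close> unless \<open>d = 0\<close>.\<close>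
    define t where "t = d / (norm y)\<^sup>2"
    have "J (a + t *\<^sub>R y) = J a - 2 * t * d + t\<^sup>2 * (norm y)\<^sup>2"
      unfolding J_def d_def power2_norm_eq_inner
      by (simp add: blinfun.bilinear_simps inner_commute algebra_simps power2_eq_square)
    also have "\<dots> = J a - d\<^sup>2 / (norm y)\<^sup>2"
      using \<open>y \<noteq> 0\<close> by (simp add: t_def field_simps power2_eq_square)
    finally show False using min[of "a + t *\<^sub>R y"] \<open>d \<noteq> 0\<close> \<open>y \<noteq> 0\<close>
      by (simp add: divide_le_0_iff)
  qed
  then show ?thesis by blast
qed

text \<open>Expanding the square gives the factor
  \<open>1 - 2 * t * \<omega> + t\<^sup>2 * M\<^sup>2\<close>, and the step size
  \<open>t = \<omega> / M\<^sup>2\<close> minimises it. Both estimates are required only for the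
  given pair \<open>x\<close>, \<open>y\<close>, so that the lemma applies to maps that are
  Lipschitz merely on a ball.\<close>

lemma strongly_monotone_contraction:
  fixes F :: "'v::real_inner \<Rightarrow> 'v"
  assumes "0 < \<omega>" "\<omega> \<le> M"
    and mono: "\<omega> * (norm (x - y))\<^sup>2 \<le> inner (F x - F y) (x - y)"
    and lip: "norm (F x - F y) \<le> M * norm (x - y)"
  shows "norm ((x - (\<omega> / M\<^sup>2) *\<^sub>R F x) - (y - (\<omega> / M\<^sup>2) *\<^sub>R F y)) \<le> sqrt (1 - (\<omega> / M)\<^sup>2) * norm (x - y)"
proof -
  define t where "t = \<omega> / M\<^sup>2"
  have "0 < M" using assms by simp
  then have t: "0 < t" "t\<^sup>2 * M\<^sup>2 = t * \<omega>" "t * \<omega> = (\<omega> / M)\<^sup>2"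
    using assms by (auto simp: t_def power2_eq_square field_simps)
  have "(norm ((x - t *\<^sub>R F x) - (y - t *\<^sub>R F y)))\<^sup>2 =
      (norm (x - y))\<^sup>2 - 2 * t * inner (F x - F y) (x - y) + t\<^sup>2 * (norm (F x - F y))\<^sup>2"
    unfolding power2_norm_eq_inner
    by (simp add: inner_commute algebra_simps power2_eq_square)
  also have "\<dots> \<le> (norm (x - y))\<^sup>2 - 2 * t * (\<omega> * (norm (x - y))\<^sup>2) + t\<^sup>2 * (M * norm (x - y))\<^sup>2"
  proof -
    have "t * (\<omega> * (norm (x - y))\<^sup>2) \<le> t * inner (F x - F y) (x - y)"
      using mono t(1) by (intro mult_left_mono) auto
    moreover have "t\<^sup>2 * (norm (F x - F y))\<^sup>2 \<le> t\<^sup>2 * (M * norm (x - y))\<^sup>2"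
      using lip by (intro mult_left_mono power_mono) auto
    ultimately show ?thesis by linarith
  qed
  also have "\<dots> = (1 - 2 * (t * \<omega>) + t\<^sup>2 * M\<^sup>2) * (norm (x - y))\<^sup>2"
    by (simp add: algebra_simps power_mult_distrib)
  also have "\<dots> = (1 - (\<omega> / M)\<^sup>2) * (norm (x - y))\<^sup>2"
    using t by simp
  finally show ?thesis
    using real_le_rsqrt by (fastforce simp: t_def real_sqrt_mult)
qed

text \<open>The range is closed by strong monotonicity and open because \<open>x \<mapsto> x - t (F x - y)\<close> is, for
  \<open>y\<close> near \<open>F x0\<close>, a contraction of the unit ball around \<open>x0\<close>; hence it is everything.\<close>

lemma strongly_monotone_surj:
  fixes F :: "'v::{real_inner,banach} \<Rightarrow> 'v"
  assumes "0 < \<omega>"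
    and mono: "\<And>x y. \<omega> * (norm (x - y))\<^sup>2 \<le> inner (F x - F y) (x - y)"
    and lip: "\<And>R. \<exists>M. M-lipschitz_on (cball 0 R) F"
  shows "surj F"
proof -
  \<comment> \<open>By Cauchy-Schwarz, \<open>F\<close> expands distances by at least \<omega>.
    Preimages of a convergent sequence are therefore Cauchy, which makes the range closed.\<close>
  have inj: "\<omega> * norm (x - y) \<le> norm (F x - F y)" for x y
  proof (cases "x = y")
    case False
    have "\<omega> * (norm (x - y) * norm (x - y)) \<le> norm (F x - F y) * norm (x - y)"
      using mono[of x y] norm_cauchy_schwarz[of "F x - F y" "x - y"] by (simp add: power2_eq_square)
    then show ?thesis using False by simp
  qed simp
  \<comment> \<open>Enlarging the constant to at least \<omega> keeps
    \<open>1 - (\<omega> / M)\<^sup>2\<close> nonnegative, so that its root can serve as contraction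
    factor.\<close>
  have lip1: "\<exists>M\<ge>\<omega>. M-lipschitz_on (cball x0 1) F" for x0
  proof -
    obtain M where "M-lipschitz_on (cball 0 (norm x0 + 1)) F" using lip by blast
    moreover have "cball x0 1 \<subseteq> cball 0 (norm x0 + 1)"
      by (simp add: subset_iff) (metis add.commute dist_0_norm dist_commute dist_triangle_le add_left_mono)
    ultimately have "(max M \<omega>)-lipschitz_on (cball x0 1) F"
      by (meson lipschitz_on_mono lipschitz_on_le max.cobounded1 lipschitz_on_subset)
    then show ?thesis by (meson max.cobounded2)
  qed
  have cont: "continuous_on UNIV F"
  proof (clarsimp simp: continuous_on_eq_continuous_at)
    fix x0
    obtain M where "M-lipschitz_on (cball x0 1) F" using lip1 by blast
    then have "continuous_on (cball x0 1) F" by (rule lipschitz_on_continuous_on)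
    then show "isCont F x0"
      by (rule continuous_on_interior) (metis ball_subset_cball centre_in_ball interior_maximal open_ball subsetD zero_less_one)
  qed
  have "closed (range F)"
    unfolding closed_sequential_limits
  proof (intro allI impI, elim conjE)
    fix s l assume s: "\<forall>n. s n \<in> range F" and l: "s \<longlonglongrightarrow> l"
    then have "\<forall>n. \<exists>x. s n = F x" by auto
    then obtain x where x: "\<And>n. s n = F (x n)" by metis
    have "Cauchy x"
    proof (rule metric_CauchyI)
      fix r :: real assume "0 < r"
      with \<open>0 < \<omega>\<close> have "0 < \<omega> * r" by simp
      then obtain k where k: "\<And>m n. k \<le> m \<Longrightarrow> k \<le> n \<Longrightarrow> dist (s m) (s n) < \<omega> * r"
        using LIMSEQ_imp_Cauchy[OF l] unfolding Cauchy_def by meson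
      have "dist (x m) (x n) < r" if "k \<le> m" "k \<le> n" for m n
      proof -
        have "\<omega> * norm (x m - x n) < \<omega> * r"
          using inj[of "x m" "x n"] k[OF that] by (simp add: dist_norm x)
        then show ?thesis using \<open>0 < \<omega>\<close> by (simp add: dist_norm)
      qed
      then show "\<exists>M. \<forall>m\<ge>M. \<forall>n\<ge>M. dist (x m) (x n) < r" by blast
    qed
    then obtain a where "x \<longlonglongrightarrow> a"
      using Cauchy_convergent_iff convergent_def by blast
    then have "(\<lambda>n. F (x n)) \<longlonglongrightarrow> F a"
      using cont by (simp add: continuous_on_eq_continuous_at isCont_tendsto_compose)
    then have "s \<longlonglongrightarrow> F a" by (simp flip: x)
    with l have "l = F a" by (rule LIMSEQ_unique)
    then show "l \<in> range F" by simp
  qed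
  moreover have "open (range F)"
    unfolding open_contains_ball
  proof safe
    fix x0
    obtain M where M: "\<omega> \<le> M" "M-lipschitz_on (cball x0 1) F" using lip1 by blast
    define t where "t = \<omega> / M\<^sup>2"
    define q where "q = sqrt (1 - (\<omega> / M)\<^sup>2)"
    have "0 < M" "0 < t" using M(1) \<open>0 < \<omega>\<close> by (auto simp: t_def)
    have "\<omega> / M \<le> 1" "0 < \<omega> / M" using M(1) \<open>0 < \<omega>\<close> by auto
    then have q: "0 \<le> q" "q < 1"
      by (auto simp: q_def power_le_one real_sqrt_lt_1_iff)
    \<comment> \<open>For \<open>y\<close> within \<open>r\<close> of \<open>F x0\<close>, the map
      \<open>G\<close> below moves the centre \<open>x0\<close> by at most \<open>1 - q\<close>.
      Together with the factor \<open>q\<close> this keeps the unit ball invariant.\<close>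
    define r where "r = (1 - q) / t"
    have "0 < r" using q \<open>0 < t\<close> by (simp add: r_def)
    have "y \<in> range F" if y: "y \<in> ball (F x0) r" for y
    proof -
      define G where "G x = x - t *\<^sub>R F x + t *\<^sub>R y" for x
      have contr: "dist (G x) (G x') \<le> q * dist x x'" if "x \<in> cball x0 1" "x' \<in> cball x0 1" for x x'
        using strongly_monotone_contraction[where F = F and x = x and y = x', OF \<open>0 < \<omega>\<close> M(1) mono]
          lipschitz_onD[OF M(2) that]
        by (simp add: G_def t_def q_def dist_norm)
      have "norm (G x0 - x0) = t * norm (y - F x0)"
      proof -
        have "G x0 - x0 = t *\<^sub>R (y - F x0)" by (simp add: G_def algebra_simps)
        then show ?thesis using \<open>0 < t\<close> by simp
      qed
      also have "\<dots> \<le> t * r"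
        using y \<open>0 < t\<close> by (intro mult_left_mono) (auto simp: dist_norm norm_minus_commute)
      finally have G0: "dist (G x0) x0 \<le> 1 - q"
        using \<open>0 < t\<close> by (simp add: r_def dist_norm)
      have "G ` cball x0 1 \<subseteq> cball x0 1"
      proof safe
        fix x assume x: "x \<in> cball x0 1"
        have "dist (G x) x0 \<le> dist (G x) (G x0) + dist (G x0) x0" by (rule dist_triangle)
        also have "\<dots> \<le> q * dist x x0 + (1 - q)"
          using contr[OF x, of x0] G0 by simp
        also have "\<dots> \<le> q * 1 + (1 - q)"
          using x q by (intro add_right_mono mult_left_mono) (auto simp: dist_commute)
        finally show "G x \<in> cball x0 1" by (simp add: dist_commute)
      qed
      then have "\<exists>!x\<in>cball x0 1. G x = x"
        using contr q by (intro Banach_fix) (auto simp: complete_eq_closed)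
      then obtain x where "G x = x" by blast
      then have "F x = y" using \<open>0 < t\<close> by (simp add: G_def)
      then show ?thesis by blast
    qed
    then show "\<exists>r>0. ball (F x0) r \<subseteq> range F" using \<open>0 < r\<close> by blast
  qed
  ultimately show ?thesis using clopen[of "range F"] by blast
qed

section \<open>Weak equations in the dual space\<close>

lemma to_dual_apply [simp]: "to_dual e x y = inner x (e y)"
  by (simp add: to_dual_def)

lemma lipschitz_on_blinfun: "(norm f)-lipschitz_on S (blinfun_apply f)"
  by (intro lipschitz_onI) (auto simp: dist_norm simp flip: blinfun.diff_right intro: norm_blinfun)

text \<open>Riesz turns the map into the dual into a map \<open>F\<close> from \<open>V\<close> to
  \<open>V\<close>. What \<open>S\<close> lacks for coercivity in the norm of \<open>V\<close> is a
  multiple \<alpha> of the squared norm of \<open>H\<close>, and the strong monotonicity of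
  \<open>K\<close> supplies exactly this multiple. So \<open>F\<close> is strongly monotone, hence
  onto.\<close>

lemma weak_solvability:
  fixes e :: "'v::{real_inner,banach} \<Rightarrow>\<^sub>L 'h::real_inner"
    and S :: "'v \<Rightarrow>\<^sub>L 'v \<Rightarrow>\<^sub>L real" and K :: "'v \<Rightarrow> 'h"
  assumes "0 < \<omega>"
    and coercive: "\<And>w. \<omega> * (norm w)\<^sup>2 \<le> S w w + \<alpha> * (norm (e w))\<^sup>2"
    and mono: "\<And>w z. \<alpha> * (norm (e w - e z))\<^sup>2 \<le> inner (K w - K z) (e w - e z)"
    and lip: "\<And>R. \<exists>M. M-lipschitz_on (cball 0 R) K"
  shows "\<exists>w. S w + to_dual e (K w) = to_dual e g"
proof -
  have "\<exists>F. \<forall>w y. (S w + to_dual e (K w)) y = inner (F w) y"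
    using Riesz_representation by (intro choice) blast
  then obtain F where F: "(S w + to_dual e (K w)) y = inner (F w) y" for w y
    by blast
  have diff: "inner (F w - F z) y = S (w - z) y + inner (K w - K z) (e y)" for w z y
    using F[of w y] F[of z y] by (simp add: blinfun.bilinear_simps inner_diff_left)
  have "surj F"
  proof (rule strongly_monotone_surj[OF \<open>0 < \<omega>\<close>])
    show "\<omega> * (norm (w - z))\<^sup>2 \<le> inner (F w - F z) (w - z)" for w z
      using coercive[of "w - z"] mono[of w z] by (simp add: diff blinfun.bilinear_simps)
  next
    fix R
    obtain M where M: "M-lipschitz_on (cball 0 R) K" using lip by blast
    have "norm (F w - F z) \<le> (norm S + M * norm e) * norm (w - z)"
      if "w \<in> cball 0 R" "z \<in> cball 0 R" for w z
    proof -
      \<comment> \<open>The norm of \<open>F w - F z\<close> is bounded by testing the difference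
        with itself and cancelling one factor at the end.\<close>
      let ?y = "F w - F z"
      have "norm ?y * norm ?y = S (w - z) ?y + inner (K w - K z) (e ?y)"
        by (metis diff dot_square_norm power2_eq_square)
      also have "\<dots> \<le> norm S * norm (w - z) * norm ?y + M * norm (w - z) * (norm e * norm ?y)"
      proof (intro add_mono)
        have "S (w - z) ?y \<le> norm (S (w - z)) * norm ?y"
          using norm_blinfun[of "S (w - z)" ?y] by (simp add: abs_le_iff)
        also have "\<dots> \<le> norm S * norm (w - z) * norm ?y"
          by (intro mult_right_mono norm_blinfun) auto
        finally show "S (w - z) ?y \<le> norm S * norm (w - z) * norm ?y" .
        have "inner (K w - K z) (e ?y) \<le> norm (K w - K z) * norm (e ?y)"
          by (rule norm_cauchy_schwarz)
        also have "\<dots> \<le> M * norm (w - z) * (norm e * norm ?y)"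
          using lipschitz_onD[OF M that] norm_blinfun[of e ?y] lipschitz_on_nonneg[OF M]
          by (intro mult_mono) (auto simp: dist_norm)
        finally show "inner (K w - K z) (e ?y) \<le> M * norm (w - z) * (norm e * norm ?y)" .
      qed
      also have "\<dots> = ((norm S + M * norm e) * norm (w - z)) * norm ?y"
        by (simp add: algebra_simps)
      finally show ?thesis
        by (cases "norm ?y = 0") (auto simp: lipschitz_on_nonneg[OF M])
    qed
    then have "(norm S + M * norm e)-lipschitz_on (cball 0 R) F"
      using lipschitz_on_nonneg[OF M] by (intro lipschitz_onI) (auto simp: dist_norm)
    then show "\<exists>M. M-lipschitz_on (cball 0 R) F" ..
  qed
  moreover obtain x where "to_dual e g y = inner x y" for y
    using Riesz_representation by blast
  ultimately obtain w where "inner (F w) y = to_dual e g y" for y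
    by (metis surjD)
  then have "S w + to_dual e (K w) = to_dual e g"
    using F by (intro blinfun_eqI) simp
  then show ?thesis ..
qed

section \<open>Linear and monotone partial operators\<close>

lemma linear_op_scaleR:
  assumes "linear_op A" "x \<in> dom A"
  shows "c *\<^sub>R x \<in> dom A" "A \<cdot> (c *\<^sub>R x) = c *\<^sub>R (A \<cdot> x)"
proof -
  show "c *\<^sub>R x \<in> dom A"
    using assms by (simp only: linear_op_def subspace_scale)
  show "A \<cdot> (c *\<^sub>R x) = c *\<^sub>R (A \<cdot> x)"
    using assms unfolding linear_op_def by blast
qed

lemma linear_op_diff:
  assumes "linear_op A" "x \<in> dom A" "y \<in> dom A"
  shows "x - y \<in> dom A" "A \<cdot> (x - y) = A \<cdot> x - A \<cdot> y"
proof -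
  show "x - y \<in> dom A"
    using assms by (simp only: linear_op_def subspace_diff)
  have "A \<cdot> (x + (-1) *\<^sub>R y) = A \<cdot> x + A \<cdot> ((-1) *\<^sub>R y)"
    using assms linear_op_scaleR(1)[OF assms(1,3)] unfolding linear_op_def by blast
  then show "A \<cdot> (x - y) = A \<cdot> x - A \<cdot> y"
    unfolding linear_op_scaleR(2)[OF assms(1,3)] by simp
qed

lemma maximal_monotoneD:
  assumes "maximal_monotone A" "x \<in> dom A" "y \<in> dom A"
  shows "0 \<le> inner (A \<cdot> x - A \<cdot> y) (x - y)"
proof -
  have "(x, A \<cdot> x) \<in> Map.graph A" "(y, A \<cdot> y) \<in> Map.graph A"
    using assms by (auto simp: in_graphI)
  moreover have "\<forall>(x, y)\<in>Map.graph A. \<forall>(x', y')\<in>Map.graph A. 0 \<le> inner (y - y') (x - x')"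
    using assms(1) by (simp add: maximal_monotone_def monotone_graph_def)
  ultimately show ?thesis by blast
qed

lemma linear_monotone_nonneg:
  assumes "linear_op A" "maximal_monotone A" "x \<in> dom A"
  shows "0 \<le> inner (A \<cdot> x) x"
  using maximal_monotoneD[OF assms(2,3), of 0] linear_op_scaleR[OF assms(1,3), of 0] by simp

section \<open>The resolvent of a coercive selfadjoint operator\<close>

text \<open>The operator \<open>A\<close> stands for \<open>A1\<close>, whose resolvent eliminates
  the temperature from a time step.\<close>

locale coercive_operator =
  fixes e :: "'v::{real_inner,banach} \<Rightarrow>\<^sub>L 'h::{real_inner,banach}"
    and A :: "'h \<rightharpoonup> 'h" and As :: "'v \<Rightarrow>\<^sub>L 'v \<Rightarrow>\<^sub>L real"
  assumes linear: "linear_op A" and mono: "maximal_monotone A" and adj: "selfadjoint A"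
    and dom: "dom A \<subseteq> range e" and form: "weak_form e A As"
    and coercive: "\<forall>\<alpha>>0. \<exists>\<omega>>0. \<forall>w. As w w + \<alpha> * (norm (e w))\<^sup>2 \<ge> \<omega> * (norm w)\<^sup>2"
begin

lemma resolvent_unique:
  assumes "0 < h" "x \<in> dom A" "y \<in> dom A" "x + h *\<^sub>R (A \<cdot> x) = y + h *\<^sub>R (A \<cdot> y)"
  shows "x = y"
proof -
  have "x - y = - (h *\<^sub>R (A \<cdot> x - A \<cdot> y))"
    using assms(4) by (simp add: algebra_simps)
  then have "inner (x - y) (x - y) = - (h * inner (A \<cdot> x - A \<cdot> y) (x - y))"
    by (metis inner_minus_left inner_scaleR_left)
  also have "\<dots> \<le> 0"
    using maximal_monotoneD[OF mono assms(2,3)] assms(1) by simp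
  finally have "inner (x - y) (x - y) = 0"
    using inner_ge_zero by (rule antisym)
  then show ?thesis by simp
qed

text \<open>By selfadjointness a weak solution of \<open>x + h A x = f\<close> already lies in \<open>D(A)\<close>, so the
  range condition needs no appeal to Minty's theorem.\<close>

lemma resolvent_exists:
  assumes "0 < h"
  shows "\<exists>x\<in>dom A. x + h *\<^sub>R (A \<cdot> x) = f"
proof -
  \<comment> \<open>The shift is \<open>inverse h\<close> because multiplication by \<open>h\<close>
    turns it into 1, the monotonicity constant of the identity term.\<close>
  obtain \<omega> where \<omega>: "0 < \<omega>" "\<And>w. \<omega> * (norm w)\<^sup>2 \<le> As w w + inverse h * (norm (e w))\<^sup>2"
    using coercive assms by (meson positive_imp_inverse_positive)
  have "\<exists>w. (h *\<^sub>R As) w + to_dual e (e w) = to_dual e f"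
  proof (rule weak_solvability)
    show "0 < h * \<omega>" using assms \<omega> by simp
    show "h * \<omega> * (norm w)\<^sup>2 \<le> (h *\<^sub>R As) w w + 1 * (norm (e w))\<^sup>2" for w
      using mult_left_mono[OF \<omega>(2)[of w], of h] assms
      by (simp add: blinfun.bilinear_simps distrib_left mult.assoc flip: mult.assoc[of h "inverse h"])
    show "1 * (norm (e w - e z))\<^sup>2 \<le> inner (e w - e z) (e w - e z)" for w z
      by (simp add: power2_norm_eq_inner)
    show "\<exists>M. M-lipschitz_on (cball 0 R) e" for R
      using lipschitz_on_blinfun by blast
  qed
  then obtain w where "(h *\<^sub>R As) w + to_dual e (e w) = to_dual e f" ..
  then have "((h *\<^sub>R As) w + to_dual e (e w)) y = to_dual e f y" for y by simp
  then have w: "h * As w y = inner (f - e w) (e y)" for y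
    by (simp add: blinfun.bilinear_simps inner_diff_left algebra_simps)
  have "inner (A \<cdot> x) (e w) = inner x ((f - e w) /\<^sub>R h)" if "x \<in> dom A" for x
  proof -
    obtain y where y: "x = e y" using dom \<open>x \<in> dom A\<close> by blast
    have "inner (A \<cdot> x) (e w) = As y w"
      using form that unfolding weak_form_def y by simp
    also have "\<dots> = As w y" using form by (simp add: weak_form_def)
    also have "\<dots> = inverse h * inner (f - e w) (e y)"
      using assms by (simp flip: w)
    also have "\<dots> = inner x ((f - e w) /\<^sub>R h)"
      by (simp add: y inner_commute[of "f - e w"])
    finally show ?thesis .
  qed
  then have "(e w, (f - e w) /\<^sub>R h) \<in> adjoint_graph A"
    by (simp add: adjoint_graph_def)
  then have "(e w, (f - e w) /\<^sub>R h) \<in> Map.graph A"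
    using adj by (simp add: selfadjoint_def)
  then have "A (e w) = Some ((f - e w) /\<^sub>R h)" by (rule in_graphD)
  then show ?thesis using assms by (intro bexI[of _ "e w"]) (auto simp: domI)
qed

lemma resolvent:
  assumes "0 < h"
  shows "resolvent A h f \<in> dom A" "resolvent A h f + h *\<^sub>R (A \<cdot> resolvent A h f) = f"
proof -
  have "\<exists>!x. x \<in> dom A \<and> x + h *\<^sub>R (A \<cdot> x) = f"
    using resolvent_exists[OF assms] resolvent_unique[OF assms] by blast
  then have "resolvent A h f \<in> dom A \<and> resolvent A h f + h *\<^sub>R (A \<cdot> resolvent A h f) = f"
    unfolding resolvent_def by (rule theI')
  then show "resolvent A h f \<in> dom A" "resolvent A h f + h *\<^sub>R (A \<cdot> resolvent A h f) = f" by auto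
qed

lemma resolvent_eqI:
  assumes "0 < h" "x \<in> dom A" "x + h *\<^sub>R (A \<cdot> x) = f"
  shows "resolvent A h f = x"
  by (rule resolvent_unique[OF assms(1) resolvent(1)[OF assms(1)] assms(2)])
    (rule trans[OF resolvent(2)[OF assms(1)] assms(3)[symmetric]])

lemma resolvent_diff:
  assumes "0 < h"
  shows "resolvent A h (f - g) = resolvent A h f - resolvent A h g"
proof (rule resolvent_eqI[OF assms])
  note R = resolvent[OF assms]
  show "resolvent A h f - resolvent A h g \<in> dom A"
    using linear_op_diff[OF linear R(1) R(1)] by blast
  show "resolvent A h f - resolvent A h g + h *\<^sub>R (A \<cdot> (resolvent A h f - resolvent A h g)) = f - g"
    using R(2)[of f] R(2)[of g] unfolding linear_op_diff(2)[OF linear R(1) R(1)]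
    by (simp add: algebra_simps)
qed

lemma resolvent_scaleR:
  assumes "0 < h"
  shows "resolvent A h (c *\<^sub>R f) = c *\<^sub>R resolvent A h f"
proof (rule resolvent_eqI[OF assms])
  note R = resolvent[OF assms]
  show "c *\<^sub>R resolvent A h f \<in> dom A"
    using linear_op_scaleR[OF linear R(1)] by blast
  show "c *\<^sub>R resolvent A h f + h *\<^sub>R (A \<cdot> (c *\<^sub>R resolvent A h f)) = c *\<^sub>R f"
    using arg_cong[OF R(2)[of f], of "scaleR c"] unfolding linear_op_scaleR(2)[OF linear R(1)]
    by (simp add: algebra_simps)
qed

lemma norm_resolvent_le:
  assumes "0 < h"
  shows "norm (resolvent A h f) \<le> norm f"
proof -
  define y where "y = resolvent A h f"
  have y: "y \<in> dom A" "y + h *\<^sub>R (A \<cdot> y) = f"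
    using resolvent[OF assms] by (auto simp: y_def)
  have "0 \<le> inner (A \<cdot> y) y"
    using linear_monotone_nonneg[OF linear mono y(1)] .
  then have "inner y y \<le> inner (y + h *\<^sub>R (A \<cdot> y)) y"
    using assms by (simp add: inner_add_left)
  also have "\<dots> \<le> norm f * norm y"
    unfolding y(2) by (rule norm_cauchy_schwarz)
  finally have "norm y * norm y \<le> norm f * norm y"
    by (simp add: power2_norm_eq_inner flip: power2_eq_square)
  then show ?thesis
    by (cases "norm y = 0") (auto simp: y_def)
qed

end

section \<open>The equation of a single time step\<close>

text \<open>Here \<open>c\<close> is the coercivity constant of \<open>L\<close> and
  \<open>C\<close> the Lipschitz constant of \<open>LL\<close>; \<open>small\<close> is the step
  size restriction under which \<open>L\<close> dominates the perturbation by
  \<open>LL\<close>.\<close>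

locale time_step = coercive_operator e A1 A1s
  for e :: "'v::{real_inner,banach} \<Rightarrow>\<^sub>L 'h::{real_inner,banach}" and A1 A1s +
  fixes L :: "'h \<Rightarrow>\<^sub>L 'h" and LL :: "'h \<Rightarrow> 'h" and A2 B1 B2 \<Phi> :: "'h \<rightharpoonup> 'h"
    and A2s B1s :: "'v \<Rightarrow>\<^sub>L 'v \<Rightarrow>\<^sub>L real" and c C \<eta> h :: real
  assumes h: "0 < h" and \<eta>: "0 < \<eta>" and small: "h\<^sup>2 * C < c"
    and L_coercive: "\<And>w. c * (norm w)\<^sup>2 \<le> inner (L w) w"
    and LL_lipschitz: "C-lipschitz_on UNIV LL"
    and A2: "maximal_monotone A2" "dom A2 \<subseteq> range e"
    and A2s_coercive: "\<forall>\<alpha>>0. \<exists>\<omega>>0. \<forall>w. A2s w w + \<alpha> * (norm (e w))\<^sup>2 \<ge> \<omega> * (norm w)\<^sup>2"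
    and B1: "linear_op B1" "maximal_monotone B1"
    and B1s_nonneg: "\<And>w. 0 \<le> B1s w w"
    and B2: "linear_op B2" "maximal_monotone B2" "dom A1 \<subseteq> dom B2"
    and B2_A1: "\<forall>w\<in>dom A1. inner (B2 \<cdot> w) (A1 \<cdot> w) \<ge> 0"
    and B2_bound: "\<exists>D>0. \<forall>w\<in>dom A1. norm (B2 \<cdot> w) \<le> D * (norm (A1 \<cdot> w) + norm w)"
    and \<Phi>: "maximal_monotone \<Phi>" "range e \<subseteq> dom \<Phi>"
    and \<Phi>_growth: "\<exists>p>0. \<exists>q>0. \<exists>D>0. \<forall>w z. norm (\<Phi> \<cdot> e w - \<Phi> \<cdot> e z)
         \<le> D * (1 + norm w powr p + norm z powr q) * norm (w - z)"
begin

abbreviation J :: "'h \<Rightarrow> 'h"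
  where "J \<equiv> resolvent A1 h"

text \<open>The part of the reduced equation that takes values in \<open>H\<close> on all of
  \<open>V\<close>. The terms with \<open>B1\<close> and \<open>A2\<close> are kept apart because on
  \<open>V\<close> they are available only through the forms \<open>B1s\<close> and
  \<open>A2s\<close>.\<close>

definition K :: "'h \<Rightarrow> 'h" where
  "K x = L x + h\<^sup>2 *\<^sub>R (\<Phi> \<cdot> x) + h\<^sup>2 *\<^sub>R LL x + (\<eta> * h\<^sup>2) *\<^sub>R (B2 \<cdot> J x)"

lemma J_dom_B2: "J x \<in> dom B2"
  using resolvent(1)[OF h] B2(3) by blast

lemma B2_J_diff: "B2 \<cdot> J (x - y) = B2 \<cdot> J x - B2 \<cdot> J y"
  unfolding resolvent_diff[OF h] by (rule linear_op_diff(2)[OF B2(1) J_dom_B2 J_dom_B2])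

lemma B2_J_scaleR: "B2 \<cdot> J (r *\<^sub>R x) = r *\<^sub>R (B2 \<cdot> J x)"
  unfolding resolvent_scaleR[OF h] by (rule linear_op_scaleR(2)[OF B2(1) J_dom_B2])

text \<open>Writing \<open>x\<close> as \<open>J x + h *\<^sub>R (A1 \<cdot> J x)\<close> splits the
  product into one term covered by monotonicity of \<open>B2\<close> and one covered by the sign
  condition \<open>B2_A1\<close>.\<close>

lemma B2_J_nonneg: "0 \<le> inner (B2 \<cdot> J x) x"
proof -
  have "inner (B2 \<cdot> J x) x = inner (B2 \<cdot> J x) (J x + h *\<^sub>R (A1 \<cdot> J x))"
    by (simp add: resolvent(2)[OF h])
  also have "\<dots> = inner (B2 \<cdot> J x) (J x) + h * inner (B2 \<cdot> J x) (A1 \<cdot> J x)"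
    by (simp add: inner_add_right)
  finally show ?thesis
    using linear_monotone_nonneg[OF B2(1,2) J_dom_B2] B2_A1 resolvent(1)[OF h] h by simp
qed

text \<open>\<open>B2\<close> is controlled by \<open>A1\<close>, and
  \<open>h *\<^sub>R (A1 \<cdot> J x) = x - J x\<close> is controlled by \<open>x\<close>. The bound
  depends on \<open>h\<close>, which is fixed here.\<close>

lemma B2_J_bounded: "\<exists>M\<ge>0. \<forall>x. norm (B2 \<cdot> J x) \<le> M * norm x"
proof -
  obtain D where D: "0 < D" "\<And>w. w \<in> dom A1 \<Longrightarrow> norm (B2 \<cdot> w) \<le> D * (norm (A1 \<cdot> w) + norm w)"
    using B2_bound by blast
  have "norm (B2 \<cdot> J x) \<le> (D * (2 / h + 1)) * norm x" for x
  proof -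
    have "h *\<^sub>R (A1 \<cdot> J x) = x - J x"
      using resolvent(2)[OF h, of x] by (metis add_diff_cancel_left')
    then have "h * norm (A1 \<cdot> J x) = norm (x - J x)"
      using h by (metis norm_scaleR abs_of_pos)
    also have "\<dots> \<le> 2 * norm x"
      using norm_triangle_ineq4[of x "J x"] norm_resolvent_le[OF h, of x] by simp
    finally have "norm (A1 \<cdot> J x) \<le> 2 / h * norm x"
      using h by (simp add: field_simps)
    then have "norm (A1 \<cdot> J x) + norm (J x) \<le> (2 / h + 1) * norm x"
      using norm_resolvent_le[OF h, of x] by (simp add: distrib_right)
    then have "D * (norm (A1 \<cdot> J x) + norm (J x)) \<le> D * ((2 / h + 1) * norm x)"
      using D(1) by (intro mult_left_mono) auto
    then show ?thesis
      using D(2)[OF resolvent(1)[OF h], of x] by (simp add: mult.assoc)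
  qed
  moreover have "0 \<le> D * (2 / h + 1)" using D(1) h by simp
  ultimately show ?thesis by blast
qed

text \<open>\<open>L\<close> contributes \<open>c\<close>, \<open>LL\<close> costs at most
  \<open>h\<^sup>2 * C\<close>, and the other two terms are monotone.\<close>

lemma K_strongly_monotone:
  assumes "x \<in> dom \<Phi>" "y \<in> dom \<Phi>"
  shows "(c - h\<^sup>2 * C) * (norm (x - y))\<^sup>2 \<le> inner (K x - K y) (x - y)"
proof -
  have "K x - K y = L (x - y) + h\<^sup>2 *\<^sub>R (\<Phi> \<cdot> x - \<Phi> \<cdot> y) + h\<^sup>2 *\<^sub>R (LL x - LL y)
      + (\<eta> * h\<^sup>2) *\<^sub>R (B2 \<cdot> J (x - y))"
    unfolding K_def B2_J_diff by (simp add: blinfun.bilinear_simps algebra_simps)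
  then have "inner (K x - K y) (x - y) = inner (L (x - y)) (x - y)
      + h\<^sup>2 * inner (\<Phi> \<cdot> x - \<Phi> \<cdot> y) (x - y) + h\<^sup>2 * inner (LL x - LL y) (x - y)
      + (\<eta> * h\<^sup>2) * inner (B2 \<cdot> J (x - y)) (x - y)"
    by (simp only: inner_add_left inner_scaleR_left)
  moreover have "0 \<le> h\<^sup>2 * inner (\<Phi> \<cdot> x - \<Phi> \<cdot> y) (x - y)"
    using maximal_monotoneD[OF \<Phi>(1) assms] by simp
  moreover have "0 \<le> (\<eta> * h\<^sup>2) * inner (B2 \<cdot> J (x - y)) (x - y)"
    using B2_J_nonneg \<eta> by simp
  moreover have "- (h\<^sup>2 * C * (norm (x - y))\<^sup>2) \<le> h\<^sup>2 * inner (LL x - LL y) (x - y)"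
  proof -
    have "\<bar>inner (LL x - LL y) (x - y)\<bar> \<le> norm (LL x - LL y) * norm (x - y)"
      by (rule Cauchy_Schwarz_ineq2)
    also have "\<dots> \<le> C * norm (x - y) * norm (x - y)"
      using lipschitz_onD[OF LL_lipschitz, of x y] by (intro mult_right_mono) (auto simp: dist_norm)
    finally have "- (C * (norm (x - y))\<^sup>2) \<le> inner (LL x - LL y) (x - y)"
      by (simp add: power2_eq_square abs_le_iff)
    then have "h\<^sup>2 * - (C * (norm (x - y))\<^sup>2) \<le> h\<^sup>2 * inner (LL x - LL y) (x - y)"
      by (rule mult_left_mono) simp
    then show ?thesis by (simp add: mult.assoc)
  qed
  ultimately show ?thesis
    using L_coercive[of "x - y"] unfolding left_diff_distrib by linarith
qed

text \<open>Only the \<Phi> term brings in the radius, through the powers of the norms in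
  \<open>\<Phi>_growth\<close>; the other terms are globally Lipschitz.\<close>

lemma K_lipschitz: "\<exists>M. M-lipschitz_on (cball 0 R) (\<lambda>w. K (e w))"
proof -
  obtain M where M: "0 \<le> M" "\<And>x. norm (B2 \<cdot> J x) \<le> M * norm x"
    using B2_J_bounded by blast
  obtain p q D where pqD: "0 < p" "0 < q" "0 < D" "\<And>w z. norm (\<Phi> \<cdot> e w - \<Phi> \<cdot> e z)
      \<le> D * (1 + norm w powr p + norm z powr q) * norm (w - z)"
    using \<Phi>_growth by blast
  have e: "(norm e)-lipschitz_on (cball 0 R) e"
    by (rule lipschitz_on_blinfun)
  have 1: "(norm L * norm e)-lipschitz_on (cball 0 R) (\<lambda>w. L (e w))"
    by (rule lipschitz_on_compose2[OF e lipschitz_on_blinfun])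
  have 2: "(D * (1 + R powr p + R powr q))-lipschitz_on (cball (0::'v) R) (\<lambda>w. \<Phi> \<cdot> e w)"
  proof (rule lipschitz_onI)
    fix w z :: 'v assume wz: "w \<in> cball 0 R" "z \<in> cball 0 R"
    have "D * (1 + norm w powr p + norm z powr q) * norm (w - z)
        \<le> D * (1 + R powr p + R powr q) * norm (w - z)"
      using pqD(1-3) wz by (intro mult_right_mono mult_left_mono add_mono powr_mono2) auto
    then show "dist (\<Phi> \<cdot> e w) (\<Phi> \<cdot> e z) \<le> D * (1 + R powr p + R powr q) * dist w z"
      using pqD(4)[of w z] by (simp add: dist_norm)
  qed (use pqD(3) in simp)
  have 3: "(C * norm e)-lipschitz_on (cball 0 R) (\<lambda>w. LL (e w))"
    by (rule lipschitz_on_compose2[OF e lipschitz_on_subset[OF LL_lipschitz]]) simp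
  have "M-lipschitz_on UNIV (\<lambda>x. B2 \<cdot> J x)"
    using M by (intro lipschitz_onI) (auto simp: dist_norm simp flip: B2_J_diff)
  then have 4: "(M * norm e)-lipschitz_on (cball 0 R) (\<lambda>w. B2 \<cdot> J (e w))"
    by (rule lipschitz_on_compose2[OF e lipschitz_on_subset]) simp
  show ?thesis
    unfolding K_def
    using lipschitz_on_add[OF lipschitz_on_add[OF lipschitz_on_add[OF 1 lipschitz_on_cmult[OF 2]]
        lipschitz_on_cmult[OF 3]] lipschitz_on_cmult[OF 4]] by blast
qed

lemma weak_solution_exists: "\<exists>w. (h *\<^sub>R B1s + h\<^sup>2 *\<^sub>R A2s) w + to_dual e (K (e w)) = to_dual e g"
proof -
  \<comment> \<open>After \<open>A2s\<close> is scaled by \<open>h\<^sup>2\<close>, this shift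
    becomes \<open>c - h\<^sup>2 * C\<close>, the strong monotonicity constant of
    \<open>K\<close>.\<close>
  define \<alpha> where "\<alpha> = (c - h\<^sup>2 * C) / h\<^sup>2"
  have "0 < \<alpha>" using h small by (simp add: \<alpha>_def)
  then obtain \<omega> where \<omega>: "0 < \<omega>" "\<And>w. \<omega> * (norm w)\<^sup>2 \<le> A2s w w + \<alpha> * (norm (e w))\<^sup>2"
    using A2s_coercive by blast
  show ?thesis
  proof (rule weak_solvability)
    show "0 < h\<^sup>2 * \<omega>" using h \<omega> by simp
    show "h\<^sup>2 * \<omega> * (norm w)\<^sup>2 \<le> (h *\<^sub>R B1s + h\<^sup>2 *\<^sub>R A2s) w w + (c - h\<^sup>2 * C) * (norm (e w))\<^sup>2" for w
    proof -
      have "h\<^sup>2 * (\<omega> * (norm w)\<^sup>2) \<le> h\<^sup>2 * (A2s w w + \<alpha> * (norm (e w))\<^sup>2)"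
        using \<omega>(2)[of w] by (rule mult_left_mono) simp
      moreover have "h\<^sup>2 * \<alpha> = c - h\<^sup>2 * C" using h by (simp add: \<alpha>_def)
      then have "h\<^sup>2 * (\<alpha> * (norm (e w))\<^sup>2) = (c - h\<^sup>2 * C) * (norm (e w))\<^sup>2"
        by (simp only: mult.assoc[symmetric])
      moreover have "0 \<le> h * B1s w w" using h B1s_nonneg[of w] by simp
      ultimately show ?thesis
        by (simp add: blinfun.add_left blinfun.scaleR_left distrib_left mult.assoc)
    qed
    show "(c - h\<^sup>2 * C) * (norm (e w - e z))\<^sup>2 \<le> inner (K (e w) - K (e z)) (e w - e z)" for w z
      using \<Phi>(2) by (intro K_strongly_monotone) auto
  qed (rule K_lipschitz)
qed

text \<open>Subtract the two equations and pair with \<open>x - y\<close>: \<open>K\<close> gives a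
  positive multiple of the squared distance, while moving the monotone terms with \<open>B1\<close>
  and \<open>A2\<close> to the other side makes it at most 0.\<close>

lemma strong_solution_unique:
  assumes "x \<in> dom B1 \<inter> dom A2" "y \<in> dom B1 \<inter> dom A2"
    and "K x + h *\<^sub>R (B1 \<cdot> x) + h\<^sup>2 *\<^sub>R (A2 \<cdot> x) = K y + h *\<^sub>R (B1 \<cdot> y) + h\<^sup>2 *\<^sub>R (A2 \<cdot> y)"
  shows "x = y"
proof -
  have "(c - h\<^sup>2 * C) * (norm (x - y))\<^sup>2 \<le> inner (K x - K y) (x - y)"
    using assms(1,2) A2(2) \<Phi>(2) by (intro K_strongly_monotone) blast+
  also have "K x - K y = - (h *\<^sub>R (B1 \<cdot> x - B1 \<cdot> y) + h\<^sup>2 *\<^sub>R (A2 \<cdot> x - A2 \<cdot> y))"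
    using assms(3) by (simp add: algebra_simps)
  also have "inner \<dots> (x - y) = - (h * inner (B1 \<cdot> x - B1 \<cdot> y) (x - y)
      + h\<^sup>2 * inner (A2 \<cdot> x - A2 \<cdot> y) (x - y))"
    by (simp only: inner_minus_left inner_add_left inner_scaleR_left)
  also have "- (h * inner (B1 \<cdot> x - B1 \<cdot> y) (x - y)
      + h\<^sup>2 * inner (A2 \<cdot> x - A2 \<cdot> y) (x - y)) \<le> 0"
  proof -
    have "0 \<le> h * inner (B1 \<cdot> x - B1 \<cdot> y) (x - y)"
      using maximal_monotoneD[OF B1(2)] assms(1,2) h by simp
    moreover have "0 \<le> h\<^sup>2 * inner (A2 \<cdot> x - A2 \<cdot> y) (x - y)"
      using maximal_monotoneD[OF A2(1)] assms(1,2) by simp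
    ultimately show ?thesis by linarith
  qed
  finally have "norm (x - y) = 0"
    using small by (simp add: mult_le_0_iff)
  then show ?thesis by simp
qed

section \<open>Reduction of the coupled system to one equation\<close>

text \<open>One step of the scheme with the new \<open>v\<close> and \<open>z\<close> replaced by
  difference quotients. Membership in \<open>dom B2\<close> and \<open>dom \<Phi>\<close> is left
  out since it follows from membership in \<open>dom A1\<close> and \<open>dom A2\<close>.\<close>

definition step :: "'h \<Rightarrow> 'h \<Rightarrow> 'h \<Rightarrow> 'h \<Rightarrow> 'h \<Rightarrow> bool" where
  "step \<theta>n \<phi>n vn \<theta> \<phi> \<longleftrightarrow> \<theta> \<in> dom A1 \<and> \<phi> \<in> dom A2 \<and> (\<phi> - \<phi>n) /\<^sub>R h \<in> dom B1 \<and>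
     (\<theta> - \<theta>n) /\<^sub>R h + \<eta> *\<^sub>R ((\<phi> - \<phi>n) /\<^sub>R h) + A1 \<cdot> \<theta> = 0 \<and>
     L (((\<phi> - \<phi>n) /\<^sub>R h - vn) /\<^sub>R h) + B1 \<cdot> ((\<phi> - \<phi>n) /\<^sub>R h) + A2 \<cdot> \<phi> + \<Phi> \<cdot> \<phi> + LL \<phi> = B2 \<cdot> \<theta>"

text \<open>The first equation gives \<open>\<theta> = J (\<theta>n + \<eta> \<phi>n - \<eta> \<phi>)\<close>; inserting it into \<open>h\<^sup>2\<close> times the
  second one leaves a single equation for \<open>\<phi>\<close>.\<close>

lemma step_iff:
  assumes \<phi>n: "\<phi>n \<in> dom B1"
  shows "step \<theta>n \<phi>n vn \<theta> \<phi> \<longleftrightarrow>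
    \<theta> = J (\<theta>n + \<eta> *\<^sub>R \<phi>n - \<eta> *\<^sub>R \<phi>) \<and> \<phi> \<in> dom B1 \<inter> dom A2 \<and>
    K \<phi> + h *\<^sub>R (B1 \<cdot> \<phi>) + h\<^sup>2 *\<^sub>R (A2 \<cdot> \<phi>)
      = L \<phi>n + h *\<^sub>R L vn + h *\<^sub>R (B1 \<cdot> \<phi>n) + h\<^sup>2 *\<^sub>R (B2 \<cdot> J (\<theta>n + \<eta> *\<^sub>R \<phi>n))"
proof -
  have dom: "(\<phi> - \<phi>n) /\<^sub>R h \<in> dom B1 \<longleftrightarrow> \<phi> \<in> dom B1"
  proof
    assume "(\<phi> - \<phi>n) /\<^sub>R h \<in> dom B1"
    \<comment> \<open>The sum is written as a difference with factor -1 to match the closure lemmas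
      for differences and multiples.\<close>
    then have "h *\<^sub>R ((\<phi> - \<phi>n) /\<^sub>R h) - (-1) *\<^sub>R \<phi>n \<in> dom B1"
      by (rule linear_op_diff(1)[OF B1(1) linear_op_scaleR(1)[OF B1(1)] linear_op_scaleR(1)[OF B1(1) \<phi>n]])
    moreover have "h *\<^sub>R ((\<phi> - \<phi>n) /\<^sub>R h) - (-1) *\<^sub>R \<phi>n = \<phi>" using h by simp
    ultimately show "\<phi> \<in> dom B1" by (simp only:)
  next
    assume "\<phi> \<in> dom B1"
    then show "(\<phi> - \<phi>n) /\<^sub>R h \<in> dom B1"
      by (intro linear_op_diff(1)[OF B1(1)] linear_op_scaleR(1)[OF B1(1)] \<phi>n)
  qed
  have \<theta>: "\<theta> \<in> dom A1 \<and> (\<theta> - \<theta>n) /\<^sub>R h + \<eta> *\<^sub>R ((\<phi> - \<phi>n) /\<^sub>R h) + A1 \<cdot> \<theta> = 0 \<longleftrightarrow>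
      \<theta> = J (\<theta>n + \<eta> *\<^sub>R \<phi>n - \<eta> *\<^sub>R \<phi>)"
  proof -
    have "(\<theta> - \<theta>n) /\<^sub>R h + \<eta> *\<^sub>R ((\<phi> - \<phi>n) /\<^sub>R h) + A1 \<cdot> \<theta> = 0 \<longleftrightarrow>
        h *\<^sub>R ((\<theta> - \<theta>n) /\<^sub>R h + \<eta> *\<^sub>R ((\<phi> - \<phi>n) /\<^sub>R h) + A1 \<cdot> \<theta>) = 0"
      using h by simp
    also have "h *\<^sub>R ((\<theta> - \<theta>n) /\<^sub>R h + \<eta> *\<^sub>R ((\<phi> - \<phi>n) /\<^sub>R h) + A1 \<cdot> \<theta>)
        = \<theta> + h *\<^sub>R (A1 \<cdot> \<theta>) - (\<theta>n + \<eta> *\<^sub>R \<phi>n - \<eta> *\<^sub>R \<phi>)"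
      using h by (simp add: algebra_simps)
    finally have "(\<theta> - \<theta>n) /\<^sub>R h + \<eta> *\<^sub>R ((\<phi> - \<phi>n) /\<^sub>R h) + A1 \<cdot> \<theta> = 0 \<longleftrightarrow>
        \<theta> + h *\<^sub>R (A1 \<cdot> \<theta>) = \<theta>n + \<eta> *\<^sub>R \<phi>n - \<eta> *\<^sub>R \<phi>" by simp
    then show ?thesis
      using resolvent[OF h] resolvent_eqI[OF h] by blast
  qed
  have "L (((\<phi> - \<phi>n) /\<^sub>R h - vn) /\<^sub>R h) + B1 \<cdot> ((\<phi> - \<phi>n) /\<^sub>R h) + A2 \<cdot> \<phi> + \<Phi> \<cdot> \<phi> + LL \<phi> = B2 \<cdot> \<theta>
      \<longleftrightarrow> K \<phi> + h *\<^sub>R (B1 \<cdot> \<phi>) + h\<^sup>2 *\<^sub>R (A2 \<cdot> \<phi>)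
      = L \<phi>n + h *\<^sub>R L vn + h *\<^sub>R (B1 \<cdot> \<phi>n) + h\<^sup>2 *\<^sub>R (B2 \<cdot> J (\<theta>n + \<eta> *\<^sub>R \<phi>n))"
    (is "?l = ?r \<longleftrightarrow> ?l' = ?r'")
    if "\<theta> = J (\<theta>n + \<eta> *\<^sub>R \<phi>n - \<eta> *\<^sub>R \<phi>)" and "\<phi> \<in> dom B1"
  proof -
    have B1\<phi>: "B1 \<cdot> ((\<phi> - \<phi>n) /\<^sub>R h) = (B1 \<cdot> \<phi> - B1 \<cdot> \<phi>n) /\<^sub>R h"
      using linear_op_scaleR(2)[OF B1(1) linear_op_diff(1)[OF B1(1) that(2) \<phi>n]]
        linear_op_diff(2)[OF B1(1) that(2) \<phi>n] by simp
    have B2\<theta>: "B2 \<cdot> \<theta> = B2 \<cdot> J (\<theta>n + \<eta> *\<^sub>R \<phi>n) - \<eta> *\<^sub>R (B2 \<cdot> J \<phi>)"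
      unfolding that(1) by (simp add: B2_J_diff B2_J_scaleR)
    have "h\<^sup>2 *\<^sub>R (?l - ?r) = ?l' - ?r'"
      unfolding B1\<phi> B2\<theta> K_def using h
      by (simp add: blinfun.bilinear_simps algebra_simps power2_eq_square)
    then show ?thesis
      using h by (metis eq_iff_diff_eq_0 scaleR_eq_0_iff zero_eq_power2 less_irrefl)
  qed
  with dom \<theta> show ?thesis unfolding step_def by blast
qed

end

section \<open>The whole scheme by recursion over the time steps\<close>

text \<open>The assumption passes from weak to strong solutions for the equation with \<Phi> itself.
  It comes in a second locale because it is stated in terms of \<open>K\<close>, which is defined in
  the first.\<close>

locale regular_time_step = time_step +
  assumes regularity: "\<And>w g. (h *\<^sub>R B1s + h\<^sup>2 *\<^sub>R A2s) w + to_dual e (K (e w)) = to_dual e g \<Longrightarrow>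
    e w \<in> dom B1 \<inter> dom A2 \<and> K (e w) + h *\<^sub>R (B1 \<cdot> e w) + h\<^sup>2 *\<^sub>R (A2 \<cdot> e w) = g"
begin

text \<open>The new \<phi> is again in \<open>dom B1\<close> by \<open>step_iff\<close>, so the
  hypothesis on \<open>\<phi>n\<close> is reproduced and the lemma can be iterated.\<close>

lemma step_ex1:
  assumes "\<phi>n \<in> dom B1"
  shows "\<exists>\<theta> \<phi>. step \<theta>n \<phi>n vn \<theta> \<phi> \<and> (\<forall>\<theta>' \<phi>'. step \<theta>n \<phi>n vn \<theta>' \<phi>' \<longrightarrow> \<theta>' = \<theta> \<and> \<phi>' = \<phi>)"
proof -
  define g where "g = L \<phi>n + h *\<^sub>R L vn + h *\<^sub>R (B1 \<cdot> \<phi>n) + h\<^sup>2 *\<^sub>R (B2 \<cdot> J (\<theta>n + \<eta> *\<^sub>R \<phi>n))"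
  obtain \<phi> where \<phi>: "\<phi> \<in> dom B1 \<inter> dom A2" "K \<phi> + h *\<^sub>R (B1 \<cdot> \<phi>) + h\<^sup>2 *\<^sub>R (A2 \<cdot> \<phi>) = g"
    using weak_solution_exists regularity by meson
  have "step \<theta>n \<phi>n vn (J (\<theta>n + \<eta> *\<^sub>R \<phi>n - \<eta> *\<^sub>R \<phi>)) \<phi>"
    using \<phi> by (simp add: step_iff[OF assms] g_def)
  moreover have "\<theta>' = J (\<theta>n + \<eta> *\<^sub>R \<phi>n - \<eta> *\<^sub>R \<phi>) \<and> \<phi>' = \<phi>" if "step \<theta>n \<phi>n vn \<theta>' \<phi>'" for \<theta>' \<phi>'
  proof -
    from that have *: "\<theta>' = J (\<theta>n + \<eta> *\<^sub>R \<phi>n - \<eta> *\<^sub>R \<phi>')" "\<phi>' \<in> dom B1 \<inter> dom A2"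
      "K \<phi>' + h *\<^sub>R (B1 \<cdot> \<phi>') + h\<^sup>2 *\<^sub>R (A2 \<cdot> \<phi>') = g"
      unfolding step_iff[OF assms] g_def by blast+
    have "\<phi>' = \<phi>"
      by (rule strong_solution_unique[OF *(2) \<phi>(1)]) (rule trans[OF *(3) \<phi>(2)[symmetric]])
    with *(1) show ?thesis by simp
  qed
  ultimately show ?thesis by blast
qed

lemma discrete_solution_iff:
  "discrete_solution h N \<eta> L A1 A2 B1 B2 \<Phi> LL \<theta>0 \<phi>0 v0 \<theta> \<phi> \<longleftrightarrow>
    (\<exists>v. \<theta> 0 = \<theta>0 \<and> \<phi> 0 = \<phi>0 \<and> v 0 = v0 \<and>
      (\<forall>n<N. step (\<theta> n) (\<phi> n) (v n) (\<theta> (Suc n)) (\<phi> (Suc n)) \<and> v (Suc n) = delta h \<phi> n))"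
    (is "?l \<longleftrightarrow> (\<exists>v. ?r v)")
proof
  assume ?l
  then obtain v z where "\<theta> 0 = \<theta>0" "\<phi> 0 = \<phi>0" "v 0 = v0"
    and step: "\<And>n. n < N \<Longrightarrow> \<theta> (Suc n) \<in> dom A1 \<inter> dom B2 \<and> \<phi> (Suc n) \<in> dom A2 \<inter> dom \<Phi> \<and>
          v (Suc n) \<in> dom B1 \<and>
          delta h \<theta> n + \<eta> *\<^sub>R delta h \<phi> n + A1 \<cdot> \<theta> (Suc n) = 0 \<and>
          L (z (Suc n)) + B1 \<cdot> v (Suc n) + A2 \<cdot> \<phi> (Suc n) + \<Phi> \<cdot> \<phi> (Suc n) + LL (\<phi> (Suc n))
            = B2 \<cdot> \<theta> (Suc n) \<and> z (Suc n) = delta h v n \<and> v (Suc n) = delta h \<phi> n"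
    unfolding discrete_solution_def by blast
  moreover have "step (\<theta> n) (\<phi> n) (v n) (\<theta> (Suc n)) (\<phi> (Suc n)) \<and> v (Suc n) = delta h \<phi> n" if "n < N" for n
    using step[OF that] unfolding step_def delta_def by auto
  ultimately have "?r v" by blast
  then show "\<exists>v. ?r v" by (rule exI[of _ v])
next
  assume "\<exists>v. ?r v"
  then obtain v where v: "?r v" ..
  \<comment> \<open>Truncated subtraction gives \<open>z 0 = delta h v 0 = z 1\<close>, which is the
    convention of the scheme for the initial value of \<open>z\<close>.\<close>
  define z where "z n = delta h v (n - 1)" for n
  have "\<theta> (Suc n) \<in> dom A1 \<inter> dom B2 \<and> \<phi> (Suc n) \<in> dom A2 \<inter> dom \<Phi> \<and>
          v (Suc n) \<in> dom B1 \<and>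
          delta h \<theta> n + \<eta> *\<^sub>R delta h \<phi> n + A1 \<cdot> \<theta> (Suc n) = 0 \<and>
          L (z (Suc n)) + B1 \<cdot> v (Suc n) + A2 \<cdot> \<phi> (Suc n) + \<Phi> \<cdot> \<phi> (Suc n) + LL (\<phi> (Suc n))
            = B2 \<cdot> \<theta> (Suc n) \<and> z (Suc n) = delta h v n \<and> v (Suc n) = delta h \<phi> n" if "n < N" for n
  proof -
    have s: "step (\<theta> n) (\<phi> n) (v n) (\<theta> (Suc n)) (\<phi> (Suc n))" and vn: "v (Suc n) = delta h \<phi> n"
      using v that by blast+
    have "\<theta> (Suc n) \<in> dom A1" "\<phi> (Suc n) \<in> dom A2"
      using s by (simp_all only: step_def)
    moreover from this have "\<theta> (Suc n) \<in> dom B2" "\<phi> (Suc n) \<in> dom \<Phi>"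
      using A2(2) B2(3) \<Phi>(2) by blast+
    ultimately show ?thesis
      using s vn by (simp add: step_def z_def delta_def)
  qed
  moreover have "z 0 = z 1" by (simp add: z_def)
  ultimately show ?l
    unfolding discrete_solution_def using v by blast
qed

lemma discrete_solution_exists:
  assumes "\<phi>0 \<in> dom B1"
  shows "\<exists>\<theta> \<phi>. discrete_solution h N \<eta> L A1 A2 B1 B2 \<Phi> LL \<theta>0 \<phi>0 v0 \<theta> \<phi>"
proof -
  \<comment> \<open>The state contains \<open>v\<close> because a step refers to the preceding
    difference quotient. Membership of \<phi> in \<open>dom B1\<close> is the invariant that makes
    the next step solvable.\<close>
  define P where "P n s \<longleftrightarrow> (case s of (\<theta>, \<phi>, v) \<Rightarrow>
    (n = 0 \<longrightarrow> \<theta> = \<theta>0 \<and> \<phi> = \<phi>0 \<and> v = v0) \<and> \<phi> \<in> dom B1)" for n :: nat and s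
  define Q where "Q s s' \<longleftrightarrow> (case s of (\<theta>, \<phi>, v) \<Rightarrow> case s' of (\<theta>', \<phi>', v') \<Rightarrow>
    step \<theta> \<phi> v \<theta>' \<phi>' \<and> v' = (\<phi>' - \<phi>) /\<^sub>R h)" for s s'
  have "\<exists>f. \<forall>n. P n (f n) \<and> Q (f n) (f (Suc n))"
  proof (rule dependent_nat_choice)
    show "\<exists>s. P 0 s" using assms by (auto simp: P_def)
  next
    fix s n assume "P n s"
    obtain \<theta> \<phi> v where s: "s = (\<theta>, \<phi>, v)" by (cases s)
    with \<open>P n s\<close> have \<phi>: "\<phi> \<in> dom B1" by (simp add: P_def)
    obtain \<theta>' \<phi>' where step: "step \<theta> \<phi> v \<theta>' \<phi>'" using step_ex1[OF \<phi>] by blast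
    then have "\<phi>' \<in> dom B1" unfolding step_iff[OF \<phi>] by blast
    with step show "\<exists>s'. P (Suc n) s' \<and> Q s s'"
      by (intro exI[of _ "(\<theta>', \<phi>', (\<phi>' - \<phi>) /\<^sub>R h)"]) (simp add: P_def Q_def s)
  qed
  then obtain f where f: "\<And>n. P n (f n)" "\<And>n. Q (f n) (f (Suc n))" by blast
  define \<theta> \<phi> v where "\<theta> n = fst (f n)" and "\<phi> n = fst (snd (f n))" and "v n = snd (snd (f n))" for n
  have fn: "f n = (\<theta> n, \<phi> n, v n)" for n by (simp add: \<theta>_def \<phi>_def v_def)
  have "\<theta> 0 = \<theta>0 \<and> \<phi> 0 = \<phi>0 \<and> v 0 = v0"
    using f(1)[of 0] by (simp add: fn P_def)
  moreover have "step (\<theta> n) (\<phi> n) (v n) (\<theta> (Suc n)) (\<phi> (Suc n)) \<and> v (Suc n) = delta h \<phi> n" for n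
    using f(2)[of n] by (simp add: fn Q_def delta_def)
  ultimately show ?thesis
    unfolding discrete_solution_iff by blast
qed

text \<open>The scheme itself puts only the difference quotients of \<phi> into
  \<open>dom B1\<close>; starting from \<open>\<phi>0\<close>, induction carries this over to
  \<phi>.\<close>

lemma discrete_solution_in_dom:
  assumes "\<phi>0 \<in> dom B1" and "discrete_solution h N \<eta> L A1 A2 B1 B2 \<Phi> LL \<theta>0 \<phi>0 v0 \<theta> \<phi>"
    and "n \<le> N"
  shows "\<phi> n \<in> dom B1"
proof -
  obtain v where v: "\<phi> 0 = \<phi>0" "\<And>n. n < N \<Longrightarrow> step (\<theta> n) (\<phi> n) (v n) (\<theta> (Suc n)) (\<phi> (Suc n))"
    using assms(2) unfolding discrete_solution_iff by blast
  show ?thesis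
    using \<open>n \<le> N\<close>
  proof (induction n)
    case (Suc n)
    then have "\<phi> n \<in> dom B1" "n < N" by simp_all
    then show ?case using v(2) step_iff by blast
  qed (simp add: v(1) assms(1))
qed

lemma discrete_solution_unique:
  assumes "\<phi>0 \<in> dom B1" and sol: "discrete_solution h N \<eta> L A1 A2 B1 B2 \<Phi> LL \<theta>0 \<phi>0 v0 \<theta> \<phi>"
    and sol': "discrete_solution h N \<eta> L A1 A2 B1 B2 \<Phi> LL \<theta>0 \<phi>0 v0 \<theta>' \<phi>'"
    and "n \<le> N"
  shows "\<theta>' n = \<theta> n \<and> \<phi>' n = \<phi> n"
proof -
  obtain v where v: "\<theta> 0 = \<theta>0" "\<phi> 0 = \<phi>0" "v 0 = v0"
    "\<And>n. n < N \<Longrightarrow> step (\<theta> n) (\<phi> n) (v n) (\<theta> (Suc n)) (\<phi> (Suc n)) \<and> v (Suc n) = delta h \<phi> n"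
    using sol unfolding discrete_solution_iff by blast
  obtain v' where v': "\<theta>' 0 = \<theta>0" "\<phi>' 0 = \<phi>0" "v' 0 = v0"
    "\<And>n. n < N \<Longrightarrow> step (\<theta>' n) (\<phi>' n) (v' n) (\<theta>' (Suc n)) (\<phi>' (Suc n)) \<and> v' (Suc n) = delta h \<phi>' n"
    using sol' unfolding discrete_solution_iff by blast
  \<comment> \<open>The claim is strengthened by \<open>v\<close>, since the next step depends on
    it.\<close>
  have "\<theta>' n = \<theta> n \<and> \<phi>' n = \<phi> n \<and> v' n = v n"
    using \<open>n \<le> N\<close>
  proof (induction n)
    case (Suc n)
    then have IH: "\<theta>' n = \<theta> n" "\<phi>' n = \<phi> n" "v' n = v n" and n: "n < N" by simp_all
    have "\<phi> n \<in> dom B1"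
      using discrete_solution_in_dom[OF assms(1) sol] n by simp
    moreover have "step (\<theta> n) (\<phi> n) (v n) (\<theta> (Suc n)) (\<phi> (Suc n))"
      "step (\<theta> n) (\<phi> n) (v n) (\<theta>' (Suc n)) (\<phi>' (Suc n))"
      using v(4)[OF n] v'(4)[OF n] IH by simp_all
    ultimately have "\<theta>' (Suc n) = \<theta> (Suc n) \<and> \<phi>' (Suc n) = \<phi> (Suc n)"
      using step_ex1 by metis
    then show ?case
      using v(4)[OF n] v'(4)[OF n] IH by (simp add: delta_def)
  qed (simp add: v v')
  then show ?thesis by blast
qed

end

section \<open>Step size bound and verification of the regularity property\<close>

theorem theorem1p1:
  fixes e :: "'v::{real_inner,banach} \<Rightarrow>\<^sub>L 'h::{real_inner,banach}"
    and L :: "'h \<Rightarrow>\<^sub>L 'h"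
    and A1 A2 B1 B2 \<Phi> :: "'h \<rightharpoonup> 'h"
    and A1s A2s B1s B2s :: "'v \<Rightarrow>\<^sub>L 'v \<Rightarrow>\<^sub>L real"
    and LL :: "'h \<Rightarrow> 'h"
    and \<theta>0 \<phi>0 v0 :: 'h
    and T \<eta> :: real
  assumes "T > 0" and "\<eta> > 0"
    and hyp_A1: "dense_compact_embedding e"
    and hyp_A2: "\<forall>w z. inner (L w) z = inner w (L z)"
      "\<exists>c>0. \<forall>w. inner (L w) w \<ge> c * (norm w)\<^sup>2"
    and hyp_A3: "linear_op A1" "maximal_monotone A1" "selfadjoint A1" "dom A1 \<subseteq> range e"
      "linear_op A2" "maximal_monotone A2" "selfadjoint A2" "dom A2 \<subseteq> range e"
      "weak_form e A1 A1s" "weak_form e A2 A2s"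
      "\<forall>\<alpha>>0. \<exists>\<omega>>0. \<forall>w. A1s w w + \<alpha> * (norm (e w))\<^sup>2 \<ge> \<omega> * (norm w)\<^sup>2"
      "\<forall>\<alpha>>0. \<exists>\<omega>>0. \<forall>w. A2s w w + \<alpha> * (norm (e w))\<^sup>2 \<ge> \<omega> * (norm w)\<^sup>2"
    and hyp_A4: "linear_op B1" "maximal_monotone B1" "selfadjoint B1"
      "linear_op B2" "maximal_monotone B2" "selfadjoint B2"
      "dom A1 \<subseteq> dom B2" "dom B1 \<inter> dom A2 \<noteq> {}"
      "\<forall>w\<in>dom B1 \<inter> dom A2. inner (B1 \<cdot> w) (A2 \<cdot> w) \<ge> 0"
      "\<forall>w\<in>dom A1. inner (B2 \<cdot> w) (A1 \<cdot> w) \<ge> 0"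
      "\<forall>w\<in>dom B1 \<inter> dom A2. \<forall>z\<in>dom B1 \<inter> dom A2.
         inner (B1 \<cdot> w) (A2 \<cdot> z) = inner (B1 \<cdot> z) (A2 \<cdot> w)"
    and hyp_A5: "\<exists>C>0. \<forall>w\<in>dom A1. norm (B2 \<cdot> w) \<le> C * (norm (A1 \<cdot> w) + norm w)"
    and hyp_A6: "maximal_monotone \<Phi>" "\<Phi> 0 = Some 0" "range e \<subseteq> dom \<Phi>"
      "\<exists>p>0. \<exists>q>0. \<exists>C>0. \<forall>w z. norm (\<Phi> \<cdot> e w - \<Phi> \<cdot> e z)
         \<le> C * (1 + norm w powr p + norm z powr q) * norm (w - z)"
    and hyp_A7: "\<exists>i :: 'v \<Rightarrow> real. (\<forall>w. i w \<ge> 0) \<and> lower_semicontinuous i \<and> convex_on UNIV i \<and>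
         (\<forall>w z. inner (\<Phi> \<cdot> e w) (e w - e z) \<ge> i w - i z)"
    and hyp_A8: "\<forall>lam>0. yosida \<Phi> lam 0 = 0"
      "\<forall>lam>0. \<forall>w\<in>dom B1. inner (yosida \<Phi> lam w) (B1 \<cdot> w) \<ge> 0"
      "\<forall>lam>0. \<forall>w\<in>dom A2. inner (yosida \<Phi> lam w) (A2 \<cdot> w) \<ge> 0"
    and hyp_A9: "weak_form e B1 B1s" "weak_form e B2 B2s"
    and hyp_A10: "\<forall>g a b c d d' lam h w.
        a > 0 \<and> b > 0 \<and> c > 0 \<and> d > 0 \<and> d' > 0 \<and> lam > 0 \<and> h > 0 \<and>
        to_dual e (L (e w)) + a *\<^sub>R B1s w + b *\<^sub>R A2s w + c *\<^sub>R to_dual e (yosida \<Phi> lam (e w))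
          + d *\<^sub>R to_dual e (LL (e w)) + d' *\<^sub>R to_dual e (B2 \<cdot> resolvent A1 h (e w))
          = to_dual e g
        \<longrightarrow> e w \<in> dom B1 \<inter> dom A2 \<and>
          L (e w) + a *\<^sub>R (B1 \<cdot> e w) + b *\<^sub>R (A2 \<cdot> e w) + c *\<^sub>R yosida \<Phi> lam (e w)
            + d *\<^sub>R LL (e w) + d' *\<^sub>R (B2 \<cdot> resolvent A1 h (e w)) = g"
    and hyp_A11: "\<exists>C>0. C-lipschitz_on UNIV LL"
    and hyp_A12: "\<theta>0 \<in> dom A1" "A1 \<cdot> \<theta>0 \<in> range e" "\<phi>0 \<in> dom B1 \<inter> dom A2"
      "v0 \<in> dom B1 \<inter> range e"
  shows "\<exists>h0\<in>{0<..<1}. \<forall>N::nat. \<forall>h\<in>{0<..<h0}. h = T / real N \<longrightarrow>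
      (\<exists>\<theta> \<phi>. discrete_solution h N \<eta> L A1 A2 B1 B2 \<Phi> LL \<theta>0 \<phi>0 v0 \<theta> \<phi> \<and>
         (\<forall>n<N. \<theta> (Suc n) \<in> dom A1 \<and> \<phi> (Suc n) \<in> dom B1 \<inter> dom A2) \<and>
         (\<forall>\<theta>' \<phi>'. discrete_solution h N \<eta> L A1 A2 B1 B2 \<Phi> LL \<theta>0 \<phi>0 v0 \<theta>' \<phi>' \<longrightarrow>
            (\<forall>n<N. \<theta>' (Suc n) = \<theta> (Suc n) \<and> \<phi>' (Suc n) = \<phi> (Suc n))))"
proof -
  obtain c where c: "0 < c" "\<And>w. c * (norm w)\<^sup>2 \<le> inner (L w) w" using hyp_A2(2) by blast
  obtain C where C: "0 < C" "C-lipschitz_on UNIV LL" using hyp_A11 by blast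
  \<comment> \<open>The bound 1/2 keeps \<open>h0\<close> below 1 and gives
    \<open>h\<^sup>2 \<le> h\<close>; with \<open>h < c / C\<close> this yields
    \<open>h\<^sup>2 * C < c\<close>.\<close>
  define h0 where "h0 = min (1/2) (c / C)"
  have "h0 \<in> {0<..<1}" using c C by (simp add: h0_def)
  moreover have "\<exists>\<theta> \<phi>. discrete_solution h N \<eta> L A1 A2 B1 B2 \<Phi> LL \<theta>0 \<phi>0 v0 \<theta> \<phi> \<and>
         (\<forall>n<N. \<theta> (Suc n) \<in> dom A1 \<and> \<phi> (Suc n) \<in> dom B1 \<inter> dom A2) \<and>
         (\<forall>\<theta>' \<phi>'. discrete_solution h N \<eta> L A1 A2 B1 B2 \<Phi> LL \<theta>0 \<phi>0 v0 \<theta>' \<phi>' \<longrightarrow>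
            (\<forall>n<N. \<theta>' (Suc n) = \<theta> (Suc n) \<and> \<phi>' (Suc n) = \<phi> (Suc n)))"
    if "h \<in> {0<..<h0}" for N h
  proof -
    have h: "0 < h" "h < 1" "h < c / C" using that by (auto simp: h0_def)
    have "h\<^sup>2 \<le> h" using h by (simp add: power2_eq_square mult_le_one)
    then have "h\<^sup>2 * C \<le> h * C" using C(1) by simp
    also have "\<dots> < c" using h(3) C(1) by (simp add: field_simps)
    finally have small: "h\<^sup>2 * C < c" .
    have B1s: "0 \<le> B1s w w" for w
      using hyp_A9(1) unfolding weak_form_def by (metis diff_zero blinfun.zero_right)
    interpret time_step e A1 A1s L LL A2 B1 B2 \<Phi> A2s B1s c C \<eta> h
      by unfold_locales (fact hyp_A3 hyp_A4 hyp_A5 hyp_A6 h(1) \<open>\<eta> > 0\<close> small c(2) C(2) B1s)+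
    text \<open>Hypothesis (A10) concerns the Yosida approximation, but its right-hand side is
      arbitrary: moving the difference between \<open>\<Phi>\<close> and its Yosida approximation to the right
      yields regularity for the equation with \<open>\<Phi>\<close> itself, without a limit passage.\<close>
    interpret regular_time_step e A1 A1s L LL A2 B1 B2 \<Phi> A2s B1s c C \<eta> h
    proof
      fix w g assume eq: "(h *\<^sub>R B1s + h\<^sup>2 *\<^sub>R A2s) w + to_dual e (K (e w)) = to_dual e g"
      \<comment> \<open>The Yosida parameter 1 is an arbitrary choice, as \<open>hyp_A10\<close>
        covers every positive one.\<close>
      define g' where "g' = g - h\<^sup>2 *\<^sub>R (\<Phi> \<cdot> e w) + h\<^sup>2 *\<^sub>R yosida \<Phi> 1 (e w)"
      have "to_dual e (L (e w)) + h *\<^sub>R B1s w + h\<^sup>2 *\<^sub>R A2s w + h\<^sup>2 *\<^sub>R to_dual e (yosida \<Phi> 1 (e w))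
          + h\<^sup>2 *\<^sub>R to_dual e (LL (e w)) + (\<eta> * h\<^sup>2) *\<^sub>R to_dual e (B2 \<cdot> resolvent A1 h (e w))
          = to_dual e g'"
      proof (rule blinfun_eqI)
        fix y
        have "h * B1s w y + h\<^sup>2 * A2s w y + inner (K (e w)) (e y) = inner g (e y)"
          using arg_cong[OF eq, of "\<lambda>f. f y"] by (simp add: blinfun.add_left blinfun.scaleR_left)
        then show "(to_dual e (L (e w)) + h *\<^sub>R B1s w + h\<^sup>2 *\<^sub>R A2s w + h\<^sup>2 *\<^sub>R to_dual e (yosida \<Phi> 1 (e w))
          + h\<^sup>2 *\<^sub>R to_dual e (LL (e w)) + (\<eta> * h\<^sup>2) *\<^sub>R to_dual e (B2 \<cdot> resolvent A1 h (e w))) y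
          = to_dual e g' y"
          by (simp add: blinfun.add_left blinfun.scaleR_left K_def g'_def inner_add_left inner_diff_left)
      qed
      moreover have "0 < h\<^sup>2" "0 < \<eta> * h\<^sup>2" "0 < (1::real)" using h \<open>\<eta> > 0\<close> by simp_all
      ultimately have "e w \<in> dom B1 \<inter> dom A2 \<and>
          L (e w) + h *\<^sub>R (B1 \<cdot> e w) + h\<^sup>2 *\<^sub>R (A2 \<cdot> e w) + h\<^sup>2 *\<^sub>R yosida \<Phi> 1 (e w)
            + h\<^sup>2 *\<^sub>R LL (e w) + (\<eta> * h\<^sup>2) *\<^sub>R (B2 \<cdot> resolvent A1 h (e w)) = g'"
        using hyp_A10 h(1) by blast
      then show "e w \<in> dom B1 \<inter> dom A2 \<and> K (e w) + h *\<^sub>R (B1 \<cdot> e w) + h\<^sup>2 *\<^sub>R (A2 \<cdot> e w) = g"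
        by (simp add: K_def g'_def algebra_simps)
    qed
    have \<phi>0: "\<phi>0 \<in> dom B1" using hyp_A12(3) by blast
    obtain \<theta> \<phi> where sol: "discrete_solution h N \<eta> L A1 A2 B1 B2 \<Phi> LL \<theta>0 \<phi>0 v0 \<theta> \<phi>"
      using discrete_solution_exists[OF \<phi>0] by blast
    have "\<theta> (Suc n) \<in> dom A1 \<and> \<phi> (Suc n) \<in> dom B1 \<inter> dom A2" if "n < N" for n
      using sol discrete_solution_in_dom[OF \<phi>0 sol, of "Suc n"] that
      unfolding discrete_solution_def by auto
    moreover have "\<theta>' (Suc n) = \<theta> (Suc n) \<and> \<phi>' (Suc n) = \<phi> (Suc n)"
      if "discrete_solution h N \<eta> L A1 A2 B1 B2 \<Phi> LL \<theta>0 \<phi>0 v0 \<theta>' \<phi>'" "n < N" for \<theta>' \<phi>' n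
      using discrete_solution_unique[OF \<phi>0 sol that(1), of "Suc n"] that(2) by simp
    ultimately show ?thesis using sol by blast
  qed
  ultimately show ?thesis by blast
qed

end
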